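(* (Deterministic Normalization) In both $\mathbf C\lambda_{\to}$ and $\mathbf C\lambda^{\{\}}_{\to}$, if $\Gamma \vdash t: \mathscr b \rightarrowtail \mathsf s$ is derivable without using the disjunction rule $(\vee)$, then $t$ is strongly normalizable (with respect to full reduction $\to$ of $\Lambda_{\mathsf{PE}}$, resp. $\to_{\{\}}$ of $\Lambda^{\{\}}_{\mathsf{PE}}$).
   Context: $\mathbf C\lambda_{\to}$ and $\mathbf C\lambda^{\{\}}_{\to}$ are simple type systems with counting quantifiers $\mathbf C^q$ for the probabilistic event $\lambda$-calculus $\Lambda_{\mathsf{PE}}$ and its extension $\Lambda^{\{\}}_{\mathsf{PE}}$ with call-by-value application $\{t\}u$. Judgements $\Gamma\vdash t:\mathscr b\rightarrowtail\mathsf s$ attach a Boolean constraint $\mathscr b$ over sampled bits. The rule $(\vee)$ derives $\Gamma\vdash^X t:\mathscr b\rightarrowtail\mathsf s$ from $n\ge 0$ derivations of $\Gamma\vdash^X t:\mathscr b_i\rightarrowtail\mathsf s$ whenever $\mathscr b\vDash\bigvee_i\mathscr b_i$; in particular with $n=0$ it types any term under an unsatisfiable constraint. Full reduction is $\beta$-reduction together with the permutative reductions for $\oplus$, $\nu$ (and $\{\}$). *)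

theory Defs
  imports "HOL-Probability.Probability"
begin

section \<open>Terms\<close>

text \<open>
  Both term variables and names are de Bruijn indices, in two independent index spaces:
  \<open>Lam\<close> binds variable \<open>0\<close> and \<open>Nu\<close> binds name \<open>0\<close>.
  \<open>Choice a i t u\<close> is \<open>t \<oplus>\<^sub>a\<^sup>i u\<close>: it queries bit \<open>i\<close> of the
  infinite bit sequence sampled by the generator binding the name \<open>a\<close>.
  \<open>CApp t u\<close> is the call-by-value application \<open>{t}u\<close>.
  The datatype is the language with call-by-value application; the language without it is the
  fragment \<open>PE\<close>, which is closed under the reductions below.
\<close>

datatype tm =
    Var nat
  | Lam tm
  | App tm tm
  | Choice nat nat tm tm
  | Nu tm
  | CApp tm tm

primrec PE :: "tm \<Rightarrow> bool" where
  "PE (Var x) \<longleftrightarrow> True"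
| "PE (Lam t) \<longleftrightarrow> PE t"
| "PE (App t u) \<longleftrightarrow> PE t \<and> PE u"
| "PE (Choice a i t u) \<longleftrightarrow> PE t \<and> PE u"
| "PE (Nu t) \<longleftrightarrow> PE t"
| "PE (CApp t u) \<longleftrightarrow> False"

primrec names :: "tm \<Rightarrow> nat set" where
  "names (Var x) = {}"
| "names (Lam t) = names t"
| "names (App t u) = names t \<union> names u"
| "names (Choice a i t u) = insert a (names t \<union> names u)"
| "names (Nu t) = {a. Suc a \<in> names t}"
| "names (CApp t u) = names t \<union> names u"

text \<open>\<open>nshift k\<close> makes room for a new name \<open>k\<close>; the image of \<open>nshift k\<close> consists
  of the terms in which the name \<open>k\<close> is not free.\<close>

primrec nshift :: "nat \<Rightarrow> tm \<Rightarrow> tm" where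
  "nshift k (Var x) = Var x"
| "nshift k (Lam t) = Lam (nshift k t)"
| "nshift k (App t u) = App (nshift k t) (nshift k u)"
| "nshift k (Choice a i t u) = Choice (if a < k then a else Suc a) i (nshift k t) (nshift k u)"
| "nshift k (Nu t) = Nu (nshift (Suc k) t)"
| "nshift k (CApp t u) = CApp (nshift k t) (nshift k u)"

primrec vshift :: "nat \<Rightarrow> tm \<Rightarrow> tm" where
  "vshift k (Var x) = Var (if x < k then x else Suc x)"
| "vshift k (Lam t) = Lam (vshift (Suc k) t)"
| "vshift k (App t u) = App (vshift k t) (vshift k u)"
| "vshift k (Choice a i t u) = Choice a i (vshift k t) (vshift k u)"
| "vshift k (Nu t) = Nu (vshift k t)"
| "vshift k (CApp t u) = CApp (vshift k t) (vshift k u)"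

text \<open>\<open>subst t v k\<close> replaces variable \<open>k\<close> by \<open>v\<close> and lowers the variables above \<open>k\<close>;
  it captures neither variables nor names.\<close>

primrec subst :: "tm \<Rightarrow> tm \<Rightarrow> nat \<Rightarrow> tm" where
  "subst (Var x) v k = (if x < k then Var x else if x = k then v else Var (x - 1))"
| "subst (Lam t) v k = Lam (subst t (vshift 0 v) (Suc k))"
| "subst (App t u) v k = App (subst t v k) (subst u v k)"
| "subst (Choice a i t u) v k = Choice a i (subst t v k) (subst u v k)"
| "subst (Nu t) v k = Nu (subst t (nshift 0 v) k)"
| "subst (CApp t u) v k = CApp (subst t v k) (subst u v k)"

section \<open>Reduction\<close>

inductive beta :: "tm \<Rightarrow> tm \<Rightarrow> bool" where
  "beta (App (Lam t) u) (subst t u 0)"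

text \<open>The order \<open>(a, i) < (b, j)\<close> steering the commutation of choices: the generator of
  \<open>b\<close> lies in the scope of the generator of \<open>a\<close>, that is, \<open>a\<close> has the larger
  index, or \<open>a = b\<close> and \<open>i < j\<close>. Free names are outer to all bound ones.\<close>

definition label_less :: "nat \<times> nat \<Rightarrow> nat \<times> nat \<Rightarrow> bool" where
  "label_less p q \<longleftrightarrow> fst q < fst p \<or> (fst p = fst q \<and> snd p < snd q)"

inductive perm :: "tm \<Rightarrow> tm \<Rightarrow> bool" where
  idem: "perm (Choice a i t t) t"
| c1: "perm (Choice a i (Choice a i t u) v) (Choice a i t v)"
| c2: "perm (Choice a i t (Choice a i u v)) (Choice a i t v)"
| plus_lam: "perm (Lam (Choice a i t u)) (Choice a i (Lam t) (Lam u))"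
| plus_fun: "perm (App (Choice a i t u) v) (Choice a i (App t v) (App u v))"
| plus_arg: "perm (App t (Choice a i u v)) (Choice a i (App t u) (App t v))"
| plus_plus1: "label_less (a, i) (b, j) \<Longrightarrow>
    perm (Choice b j (Choice a i t u) v) (Choice a i (Choice b j t v) (Choice b j u v))"
| plus_plus2: "label_less (a, i) (b, j) \<Longrightarrow>
    perm (Choice b j t (Choice a i u v)) (Choice a i (Choice b j t u) (Choice b j t v))"
| plus_nu: "perm (Nu (Choice (Suc a) i t u)) (Choice a i (Nu t) (Nu u))"
| not_nu: "perm (Nu (nshift 0 t)) t"
| nu_lam: "perm (Lam (Nu t)) (Nu (Lam t))"
| nu_fun: "perm (App (Nu t) u) (Nu (App t (nshift 0 u)))"

inductive perm_cbv :: "tm \<Rightarrow> tm \<Rightarrow> bool" where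
  plus_cfun: "perm_cbv (CApp (Choice a i t u) v) (Choice a i (CApp t v) (CApp u v))"
| plus_carg: "perm_cbv (CApp t (Choice a i u v)) (Choice a i (CApp t u) (CApp t v))"
| nu_carg: "perm_cbv (CApp t (Nu u)) (Nu (App (nshift 0 t) u))"

inductive compat :: "(tm \<Rightarrow> tm \<Rightarrow> bool) \<Rightarrow> tm \<Rightarrow> tm \<Rightarrow> bool" for R where
  root: "R t u \<Longrightarrow> compat R t u"
| lam: "compat R t t' \<Longrightarrow> compat R (Lam t) (Lam t')"
| app1: "compat R t t' \<Longrightarrow> compat R (App t u) (App t' u)"
| app2: "compat R u u' \<Longrightarrow> compat R (App t u) (App t u')"
| choice1: "compat R t t' \<Longrightarrow> compat R (Choice a i t u) (Choice a i t' u)"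
| choice2: "compat R u u' \<Longrightarrow> compat R (Choice a i t u) (Choice a i t u')"
| nu: "compat R t t' \<Longrightarrow> compat R (Nu t) (Nu t')"
| capp1: "compat R t t' \<Longrightarrow> compat R (CApp t u) (CApp t' u)"
| capp2: "compat R u u' \<Longrightarrow> compat R (CApp t u) (CApp t u')"

definition red :: "tm \<Rightarrow> tm \<Rightarrow> bool" where
  "red = compat (sup beta perm)"

definition red_cbv :: "tm \<Rightarrow> tm \<Rightarrow> bool" where
  "red_cbv = compat (sup beta (sup perm perm_cbv))"

section \<open>Boolean constraints\<close>

datatype bform =
    Top
  | Bot
  | Bit nat nat  \<comment> \<open>\<open>Bit a i\<close> is the atom \<open>x\<^sub>a\<^sup>i\<close>\<close>
  | Not bform
  | And bform bform
  | Or bform bform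

primrec bnames :: "bform \<Rightarrow> nat set" where
  "bnames Top = {}"
| "bnames Bot = {}"
| "bnames (Bit a i) = {a}"
| "bnames (Not b) = bnames b"
| "bnames (And b c) = bnames b \<union> bnames c"
| "bnames (Or b c) = bnames b \<union> bnames c"

primrec bshift :: "bform \<Rightarrow> bform" where
  "bshift Top = Top"
| "bshift Bot = Bot"
| "bshift (Bit a i) = Bit (Suc a) i"
| "bshift (Not b) = Not (bshift b)"
| "bshift (And b c) = And (bshift b) (bshift c)"
| "bshift (Or b c) = Or (bshift b) (bshift c)"

definition big_or :: "bform list \<Rightarrow> bform" where
  "big_or bs = foldr Or bs Bot"

primrec sat :: "(nat \<Rightarrow> nat \<Rightarrow> bool) \<Rightarrow> bform \<Rightarrow> bool" where
  "sat f Top \<longleftrightarrow> True"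
| "sat f Bot \<longleftrightarrow> False"
| "sat f (Bit a i) \<longleftrightarrow> f a i"
| "sat f (Not b) \<longleftrightarrow> \<not> sat f b"
| "sat f (And b c) \<longleftrightarrow> sat f b \<and> sat f c"
| "sat f (Or b c) \<longleftrightarrow> sat f b \<or> sat f c"

definition sem :: "nat set \<Rightarrow> bform \<Rightarrow> (nat \<Rightarrow> nat \<Rightarrow> bool) set" where
  "sem X b = {f \<in> X \<rightarrow>\<^sub>E UNIV. sat f b}"

definition entails :: "nat set \<Rightarrow> bform \<Rightarrow> bform \<Rightarrow> bool" where
  "entails X b c \<longleftrightarrow> sem X b \<subseteq> sem X c"

text \<open>The product over the names in \<open>X\<close> of the fair-coin measure on Cantor space.\<close>

definition cantor :: "nat set \<Rightarrow> (nat \<Rightarrow> nat \<Rightarrow> bool) measure" where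
  "cantor X = PiM X (\<lambda>_. PiM UNIV (\<lambda>_. measure_pmf (bernoulli_pmf (1 / 2))))"

section \<open>Types\<close>

typedef weight = "{q :: rat. 0 < q \<and> q \<le> 1}"
  by (rule exI [of _ 1]) simp

setup_lifting type_definition_weight

lift_definition weight_mult :: "weight \<Rightarrow> weight \<Rightarrow> weight" is "(*)"
  by (auto intro: mult_le_one)

text \<open>
  \<open>C q \<sigma>\<close> is the counting type \<open>C\<^sup>q \<sigma>\<close>. In the call-by-name system \<open>q\<close> is a
  single weight. In the call-by-value system \<open>q\<close> is a list of weights and \<open>C [q\<^sub>1, \<dots>, q\<^sub>n] \<sigma>\<close>
  stands for the iterated \<open>C\<^bsup>q\<^sub>1\<^esup> \<dots> C\<^bsup>q\<^sub>n\<^esup> \<sigma>\<close>: there one has to know how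
  much probability is due to the outermost generator alone.
\<close>

datatype 'q ty = Base | Arr "'q cty" "'q ty"
and 'q cty = C 'q "'q ty"

section \<open>Typing\<close>

text \<open>
  In both judgements the flag \<open>d\<close> tells whether the disjunction rule is available: \<open>True\<close> gives
  the full type system, \<open>False\<close> the judgements derivable without disjunction. The context \<open>\<Gamma>\<close> lists the
  types of the free variables by index. Under a generator, \<open>X \<union> {a}\<close> becomes
  \<open>insert 0 (Suc ` X)\<close>, and a constraint over \<open>X\<close> is shifted accordingly.
\<close>

inductive typing ::
  "bool \<Rightarrow> weight cty list \<Rightarrow> nat set \<Rightarrow> tm \<Rightarrow> bform \<Rightarrow> weight cty \<Rightarrow> bool" for d :: bool where
  var: "finite X \<Longrightarrow> bnames b \<subseteq> X \<Longrightarrow> x < length \<Gamma> \<Longrightarrow> \<Gamma> ! x = s \<Longrightarrow>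
    typing d \<Gamma> X (Var x) b s"
| disj: "d \<Longrightarrow> PE t \<Longrightarrow> finite X \<Longrightarrow> names t \<subseteq> X \<Longrightarrow> bnames b \<subseteq> X \<Longrightarrow>
    (\<And>c. c \<in> set bs \<Longrightarrow> typing d \<Gamma> X t c s) \<Longrightarrow> entails X b (big_or bs) \<Longrightarrow>
    typing d \<Gamma> X t b s"
| plus: "a \<in> X \<Longrightarrow> bnames b \<subseteq> X \<Longrightarrow> typing d \<Gamma> X t c s \<Longrightarrow> typing d \<Gamma> X u e s \<Longrightarrow>
    entails X b (Or (And (Bit a i) c) (And (Not (Bit a i)) e)) \<Longrightarrow>
    typing d \<Gamma> X (Choice a i t u) b s"
| lam: "typing d (s # \<Gamma>) X t b (C q \<tau>) \<Longrightarrow> typing d \<Gamma> X (Lam t) b (C q (Arr s \<tau>))"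
| app: "bnames b \<subseteq> X \<Longrightarrow> typing d \<Gamma> X t c (C q (Arr s \<tau>)) \<Longrightarrow> typing d \<Gamma> X u e s \<Longrightarrow>
    entails X b (And c e) \<Longrightarrow>
    typing d \<Gamma> X (App t u) b (C q \<tau>)"
| count: "bnames b \<subseteq> X \<Longrightarrow> bnames e \<subseteq> {0} \<Longrightarrow>
    typing d \<Gamma> (insert 0 (Suc ` X)) t (And (bshift b) e) (C q \<sigma>) \<Longrightarrow>
    of_rat (Rep_weight r) \<le> measure (cantor {0}) (sem {0} e) \<Longrightarrow>
    typing d \<Gamma> X (Nu t) b (C (weight_mult q r) \<sigma>)"

inductive typing_cbv ::
  "bool \<Rightarrow> weight list cty list \<Rightarrow> nat set \<Rightarrow> tm \<Rightarrow> bform \<Rightarrow> weight list cty \<Rightarrow> bool"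
  for d :: bool where
  var: "finite X \<Longrightarrow> bnames b \<subseteq> X \<Longrightarrow> x < length \<Gamma> \<Longrightarrow> \<Gamma> ! x = s \<Longrightarrow>
    typing_cbv d \<Gamma> X (Var x) b s"
| disj: "d \<Longrightarrow> finite X \<Longrightarrow> names t \<subseteq> X \<Longrightarrow> bnames b \<subseteq> X \<Longrightarrow>
    (\<And>c. c \<in> set bs \<Longrightarrow> typing_cbv d \<Gamma> X t c s) \<Longrightarrow> entails X b (big_or bs) \<Longrightarrow>
    typing_cbv d \<Gamma> X t b s"
| plus: "a \<in> X \<Longrightarrow> bnames b \<subseteq> X \<Longrightarrow> typing_cbv d \<Gamma> X t c s \<Longrightarrow> typing_cbv d \<Gamma> X u e s \<Longrightarrow>
    entails X b (Or (And (Bit a i) c) (And (Not (Bit a i)) e)) \<Longrightarrow>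
    typing_cbv d \<Gamma> X (Choice a i t u) b s"
| lam: "typing_cbv d (s # \<Gamma>) X t b (C qs \<tau>) \<Longrightarrow>
    typing_cbv d \<Gamma> X (Lam t) b (C qs (Arr s \<tau>))"
| app: "bnames b \<subseteq> X \<Longrightarrow> typing_cbv d \<Gamma> X t c (C qs (Arr s \<tau>)) \<Longrightarrow> typing_cbv d \<Gamma> X u e s \<Longrightarrow>
    entails X b (And c e) \<Longrightarrow>
    typing_cbv d \<Gamma> X (App t u) b (C qs \<tau>)"
| capp: "bnames b \<subseteq> X \<Longrightarrow> typing_cbv d \<Gamma> X t c (C qs (Arr (C rs \<sigma>) \<tau>)) \<Longrightarrow>
    typing_cbv d \<Gamma> X u e (C (r # rs) \<sigma>) \<Longrightarrow> entails X b (And c e) \<Longrightarrow>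
    typing_cbv d \<Gamma> X (CApp t u) b (C (r # qs) \<tau>)"
| count: "bnames b \<subseteq> X \<Longrightarrow> bnames e \<subseteq> {0} \<Longrightarrow>
    typing_cbv d \<Gamma> (insert 0 (Suc ` X)) t (And (bshift b) e) (C qs \<sigma>) \<Longrightarrow>
    of_rat (Rep_weight r) \<le> measure (cantor {0}) (sem {0} e) \<Longrightarrow>
    typing_cbv d \<Gamma> X (Nu t) b (C (r # qs) \<sigma>)"

end

theory Submission
  imports Defs
begin

text \<open>
  Without disjunction, typing is simple typing. Erasing names, generators and the distinction between
  the two applications, and reading a choice as nondeterministic, maps typable terms into a simply
  typed lambda calculus whose reduction consists of \<open>\<beta>\<close> and the two projections of a choice; it is
  strongly normalizing by reducibility. The erasure is no simulation, since commuting two choices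
  duplicates a branch. Instead, \<open>e\<close> covers \<open>t\<close> if every branch of every choice in \<open>t\<close> is matched by
  some reduct of \<open>e\<close>. Covering by a fixed \<open>e\<close> is preserved by all reductions, and a \<open>\<beta>\<close>-step at the
  root allows \<open>e\<close> to be replaced by a proper reduct. By induction on \<open>e\<close>, covered terms are strongly
  normalizing, because choices, generators and abstractions of strongly normalizing terms are so
  even without types.
\<close>

section \<open>Termination\<close>

text \<open>The inductive form states termination along \<open>r\<close> itself, avoiding the
  converse relation inside \<open>termip\<close>.\<close>

inductive SN :: "('a \<Rightarrow> 'a \<Rightarrow> bool) \<Rightarrow> 'a \<Rightarrow> bool" for r where
  SNI: "(\<And>y. r x y \<Longrightarrow> SN r y) \<Longrightarrow> SN r x"

lemma SND: "SN r x \<Longrightarrow> r x y \<Longrightarrow> SN r y"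
  by (auto elim: SN.cases)

lemma SN_imp_termip: "SN r x \<Longrightarrow> termip r x"
proof (induction rule: SN.induct)
  case (SNI x)
  show ?case
    by (rule accpI) (use SNI in simp)
qed

lemma SN_induct [consumes 1, case_names step]:
  assumes "SN r x"
    and "\<And>x. SN r x \<Longrightarrow> (\<And>y. r x y \<Longrightarrow> P y) \<Longrightarrow> P x"
  shows "P x"
  using assms(1)
proof (induction rule: SN.induct)
  case (SNI x)
  from SNI.hyps have "SN r x"
    by (rule SN.SNI)
  then show ?case
    by (rule assms(2)) (rule SNI.IH)
qed

lemma SN_simulation:
  assumes "SN r (f x)" and "\<And>x y. r x y \<Longrightarrow> r (f x) (f y)"
  shows "SN r x"
  using assms(1)
proof (induction "f x" arbitrary: x rule: SN_induct)
  case step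
  show ?case
    by (rule SNI) (use step assms(2) in blast)
qed

lemma SN_mono:
  assumes "SN r x" and "\<And>x y. q x y \<Longrightarrow> r x y"
  shows "SN q x"
  using assms(1)
proof (induction rule: SN_induct)
  case (step x)
  show ?case
    by (rule SNI) (use step assms(2) in blast)
qed

text \<open>A \<open>c\<close>-step before an \<open>r\<close>-step can be postponed. Infinitely
  many \<open>r\<close>-steps would thus give an infinite \<open>r\<close>-sequence from
  \<open>t\<close>, and finitely many leave an infinite \<open>c\<close>-sequence. With
  \<open>c\<close> the passage to a component, this permits induction on reduction and components at
  once.\<close>

lemma SN_sup_commuting:
  assumes t: "SN r t"
    and commute: "\<And>t s s'. c t s \<Longrightarrow> r s s' \<Longrightarrow> \<exists>t'. r t t' \<and> c t' s'"
    and wf: "\<And>t. SN c t"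
  shows "SN (sup r c) t"
proof -
  have lift: "\<exists>t'. r t t' \<and> c\<^sup>*\<^sup>* t' s'" if "c\<^sup>*\<^sup>* t s" "r s s'" for t s s'
    using that
  proof (induction arbitrary: s' rule: rtranclp_induct)
    case (step y z)
    then show ?case
      by (meson commute rtranclp.rtrancl_into_rtrancl)
  qed auto
  \<comment> \<open>All \<open>c\<close>-descendants of \<open>t\<close> are treated together, so
    that an \<open>r\<close>-step of \<open>s\<close>, lifted to \<open>t\<close>, falls under the
    outer induction hypothesis.\<close>
  have "\<forall>s. c\<^sup>*\<^sup>* t s \<longrightarrow> SN (sup r c) s"
    using t
  proof (induction rule: SN_induct)
    case (step t)
    have "c\<^sup>*\<^sup>* t s \<longrightarrow> SN (sup r c) s" for s
      using wf[of s]
    proof (induction rule: SN_induct)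
      case inner: (step s)
      show ?case
      proof ((rule impI)+, rule SNI)
        fix y
        assume ts: "c\<^sup>*\<^sup>* t s" and "sup r c s y"
        then consider "r s y" | "c s y"
          by auto
        then show "SN (sup r c) y"
        proof cases
          case 1
          then show ?thesis
            using lift[OF ts] step.IH by blast
        next
          case 2
          then show ?thesis
            using ts inner.IH by (meson rtranclp.rtrancl_into_rtrancl)
        qed
      qed
    qed
    then show ?case
      by blast
  qed
  then show ?thesis
    by blast
qed

section \<open>A nondeterministic lambda calculus without names\<close>

datatype nd = V nat | L nd | A nd nd | Amb nd nd

primrec ren :: "(nat \<Rightarrow> nat) \<Rightarrow> nd \<Rightarrow> nd" where
  "ren r (V x) = V (r x)"
| "ren r (L e) = L (ren (case_nat 0 (Suc \<circ> r)) e)"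
| "ren r (A e f) = A (ren r e) (ren r f)"
| "ren r (Amb e f) = Amb (ren r e) (ren r f)"

text \<open>The lifting of a parallel substitution under a binder.\<close>

definition ups :: "(nat \<Rightarrow> nd) \<Rightarrow> nat \<Rightarrow> nd" where
  "ups \<sigma> = case_nat (V 0) (ren Suc \<circ> \<sigma>)"

lemma ups_simps [simp]: "ups \<sigma> 0 = V 0" "ups \<sigma> (Suc x) = ren Suc (\<sigma> x)"
  by (simp_all add: ups_def)

primrec psubst :: "(nat \<Rightarrow> nd) \<Rightarrow> nd \<Rightarrow> nd" where
  "psubst \<sigma> (V x) = \<sigma> x"
| "psubst \<sigma> (L e) = L (psubst (ups \<sigma>) e)"
| "psubst \<sigma> (A e f) = A (psubst \<sigma> e) (psubst \<sigma> f)"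
| "psubst \<sigma> (Amb e f) = Amb (psubst \<sigma> e) (psubst \<sigma> f)"

lemma ren_eq_psubst: "ren r e = psubst (V \<circ> r) e"
proof (induction e arbitrary: r)
  case (L e)
  have "V \<circ> case_nat 0 (Suc \<circ> r) = ups (V \<circ> r)"
    by (auto simp: fun_eq_iff split: nat.split)
  then show ?case
    by (simp only: ren.simps psubst.simps L)
qed auto

lemma psubst_V [simp]: "psubst V e = e"
proof (induction e)
  case (L e)
  have "ups V = V"
    by (auto simp: fun_eq_iff ups_def split: nat.split)
  with L show ?case
    by simp
qed auto

lemma psubst_ren: "psubst \<sigma> (ren r e) = psubst (\<sigma> \<circ> r) e"
proof (induction e arbitrary: \<sigma> r)
  case (L e)
  have "ups \<sigma> \<circ> case_nat 0 (Suc \<circ> r) = ups (\<sigma> \<circ> r)"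
    by (auto simp: fun_eq_iff ups_def split: nat.split)
  then show ?case
    by (simp only: ren.simps psubst.simps L)
qed auto

lemma ren_psubst: "ren r (psubst \<sigma> e) = psubst (ren r \<circ> \<sigma>) e"
proof (induction e arbitrary: \<sigma> r)
  case (L e)
  \<comment> \<open>Both renamings are written as substitutions and fused.\<close>
  have "ren (case_nat 0 (Suc \<circ> r)) (ren Suc f) = ren Suc (ren r f)" for f
    by (simp add: ren_eq_psubst[of _ "ren Suc f"] psubst_ren)
      (simp add: ren_eq_psubst[of Suc "ren r f"] psubst_ren, simp add: ren_eq_psubst psubst_ren comp_def)
  then have "ren (case_nat 0 (Suc \<circ> r)) \<circ> ups \<sigma> = ups (ren r \<circ> \<sigma>)"
    by (auto simp: fun_eq_iff ups_def split: nat.split)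
  then show ?case
    by (simp only: ren.simps psubst.simps L)
qed auto

lemma psubst_psubst: "psubst \<sigma> (psubst \<theta> e) = psubst (psubst \<sigma> \<circ> \<theta>) e"
proof (induction e arbitrary: \<sigma> \<theta>)
  case (L e)
  have "psubst (ups \<sigma>) \<circ> ups \<theta> = ups (psubst \<sigma> \<circ> \<theta>)"
    by (auto simp: fun_eq_iff ups_def psubst_ren ren_psubst comp_def split: nat.split)
  then show ?case
    by (simp only: ren.simps psubst.simps L)
qed auto

text \<open>This identity makes substitution commute with \<beta> and serves the abstraction case of
  reducibility.\<close>

lemma psubst_ups_instantiate:
  "psubst (case_nat u V) (psubst (ups \<sigma>) e) = psubst (case_nat u \<sigma>) e"
proof -
  have "psubst (case_nat u V) \<circ> ups \<sigma> = case_nat u \<sigma>"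
    by (auto simp: fun_eq_iff ups_def psubst_ren comp_def split: nat.split)
  then show ?thesis
    by (simp add: psubst_psubst)
qed

inductive ndred :: "nd \<Rightarrow> nd \<Rightarrow> bool" where
  beta: "ndred (A (L e) u) (psubst (case_nat u V) e)"
| proj1: "ndred (Amb e f) e"
| proj2: "ndred (Amb e f) f"
| lam: "ndred e e' \<Longrightarrow> ndred (L e) (L e')"
| app1: "ndred e e' \<Longrightarrow> ndred (A e f) (A e' f)"
| app2: "ndred f f' \<Longrightarrow> ndred (A e f) (A e f')"
| or1: "ndred e e' \<Longrightarrow> ndred (Amb e f) (Amb e' f)"
| or2: "ndred f f' \<Longrightarrow> ndred (Amb e f) (Amb e f')"

inductive_cases ndred_VE: "ndred (V x) e"
inductive_cases ndred_LE: "ndred (L e) f"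
inductive_cases ndred_AE: "ndred (A e f) g"
inductive_cases ndred_AmbE: "ndred (Amb e f) g"

lemma ndred_psubst: "ndred e f \<Longrightarrow> ndred (psubst \<sigma> e) (psubst \<sigma> f)"
proof (induction arbitrary: \<sigma> rule: ndred.induct)
  case (beta e u)
  have "psubst \<sigma> \<circ> case_nat u V = case_nat (psubst \<sigma> u) \<sigma>"
    by (auto simp: fun_eq_iff split: nat.split)
  then have "psubst \<sigma> (psubst (case_nat u V) e) =
      psubst (case_nat (psubst \<sigma> u) V) (psubst (ups \<sigma>) e)"
    by (simp add: psubst_psubst[of \<sigma>] psubst_ups_instantiate)
  then show ?case
    using ndred.beta by simp
qed (auto intro: ndred.intros)

lemma ndred_ren: "ndred e f \<Longrightarrow> ndred (ren r e) (ren r f)"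
  by (simp add: ren_eq_psubst ndred_psubst)

inductive ndchild :: "nd \<Rightarrow> nd \<Rightarrow> bool" where
  "ndchild (L e) e"
| "ndchild (A e f) e"
| "ndchild (A e f) f"
| "ndchild (Amb e f) e"
| "ndchild (Amb e f) f"

lemma SN_ndchild: "SN ndchild e"
  by (induction e; rule SNI; auto elim: ndchild.cases)

text \<open>A step inside a subterm is a step of the whole term, which is the required
  commutation.\<close>

lemma SN_ndred_child: "SN ndred e \<Longrightarrow> SN (sup ndred ndchild) e"
  by (rule SN_sup_commuting[OF _ _ SN_ndchild])
    (auto elim!: ndchild.cases intro: ndred.intros ndchild.intros)

section \<open>Reducibility\<close>

text \<open>The predicate depends only on the simple type beneath the weights, so one polymorphic
  definition serves both systems.\<close>

primrec reducible :: "'q ty \<Rightarrow> nd \<Rightarrow> bool" and creducible :: "'q cty \<Rightarrow> nd \<Rightarrow> bool" where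
  "reducible Base = SN ndred"
| "reducible (Arr s \<tau>) = (\<lambda>e. \<forall>u. creducible s u \<longrightarrow> reducible \<tau> (A e u))"
| "creducible (C q \<tau>) = reducible \<tau>"

text \<open>Girard's three conditions on reducibility candidates; every term other than an
  abstraction counts as neutral, choices included.\<close>

definition candidate :: "(nd \<Rightarrow> bool) \<Rightarrow> bool" where
  "candidate R \<longleftrightarrow>
    (\<forall>e. R e \<longrightarrow> SN ndred e) \<and>
    (\<forall>e f. R e \<longrightarrow> ndred e f \<longrightarrow> R f) \<and>
    (\<forall>e. (\<forall>f. e \<noteq> L f) \<longrightarrow> (\<forall>f. ndred e f \<longrightarrow> R f) \<longrightarrow> R e)"

lemma candidate_SN: "candidate R \<Longrightarrow> R e \<Longrightarrow> SN ndred e"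
  and candidate_ndred: "candidate R \<Longrightarrow> R e \<Longrightarrow> ndred e f \<Longrightarrow> R f"
  and candidate_neutral:
    "candidate R \<Longrightarrow> (\<And>f. e \<noteq> L f) \<Longrightarrow> (\<And>f. ndred e f \<Longrightarrow> R f) \<Longrightarrow> R e"
  unfolding candidate_def by blast+

lemma candidate_V: "candidate R \<Longrightarrow> R (V x)"
  by (erule candidate_neutral) (auto elim: ndred_VE)

text \<open>A choice is neutral, and its reducts are its two branches or choices with one branch
  reduced; hence nested induction on the termination of the branches.\<close>

lemma candidate_Amb:
  assumes R: "candidate R" and "R e" "R f"
  shows "R (Amb e f)"
proof -
  have "R e \<longrightarrow> (\<forall>f. R f \<longrightarrow> R (Amb e f))"
    using candidate_SN[OF R \<open>R e\<close>]
  proof (induction rule: SN_induct)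
    case outer: (step e)
    have "R e \<longrightarrow> R f \<longrightarrow> R (Amb e f)" if "SN ndred f" for f
      using that
    proof (induction rule: SN_induct)
      case (step f)
      show ?case
        by ((rule impI)+, rule candidate_neutral[OF R])
          (auto elim!: ndred_AmbE dest: candidate_ndred[OF R] outer.IH step.IH)
    qed
    then show ?case
      using candidate_SN[OF R] by blast
  qed
  with assms show ?thesis
    by blast
qed

lemma
  fixes \<tau> :: "'q ty" and s :: "'q cty"
  shows candidate_reducible: "candidate (reducible \<tau>)"
    and candidate_creducible: "candidate (creducible s)"
proof (induction \<tau> and s)
  case Base
  show ?case
    by (simp add: candidate_def) (blast intro: SNI SND)
next
  case (Arr s \<tau>)
  \<comment> \<open>Since \<open>e\<close> is no abstraction, \<open>A e u\<close> has no
    \<beta>-step at the root; a step in \<open>u\<close> is handled by induction on its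
    termination.\<close>
  have neutral: "reducible \<tau> (A e u)"
    if e: "\<And>f. e \<noteq> L f" "\<And>f. ndred e f \<Longrightarrow> reducible (Arr s \<tau>) f" and u: "creducible s u" for e u
    using candidate_SN[OF Arr(1) u] u
  proof (induction rule: SN_induct)
    case (step u)
    show ?case
      by (rule candidate_neutral[OF Arr(2)])
        (use step e in \<open>auto elim!: ndred_AE dest: candidate_ndred[OF Arr(1)]\<close>)
  qed
  \<comment> \<open>The variable \<open>V 0\<close> is reducible at any type, and a reduction of
    \<open>e\<close> is also one of \<open>A e (V 0)\<close>.\<close>
  have "SN ndred e" if "reducible (Arr s \<tau>) e" for e
  proof (rule SN_simulation)
    show "SN ndred (A e (V 0))"
      using that candidate_V[OF Arr(1)] candidate_SN[OF Arr(2)] by simp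
  qed (rule ndred.app1)
  moreover have "reducible (Arr s \<tau>) f" if "reducible (Arr s \<tau>) e" "ndred e f" for e f
    using that candidate_ndred[OF Arr(2) _ ndred.app1] by auto
  moreover have "reducible (Arr s \<tau>) e"
    if "\<And>f. e \<noteq> L f" "\<And>f. ndred e f \<Longrightarrow> reducible (Arr s \<tau>) f" for e
    using neutral[OF that] by simp
  ultimately show ?case
    unfolding candidate_def by blast
next
  case (C q \<tau>)
  then show ?case
    by simp
qed

lemma reducible_L:
  assumes e: "\<And>u. creducible s u \<Longrightarrow> reducible \<tau> (psubst (case_nat u V) e)"
  shows "reducible (Arr s \<tau>) (L e)"
proof -
  \<comment> \<open>Substituting a variable suffices to see that the body terminates, because
    reduction is stable under substitution.\<close>
  have "SN ndred (psubst (case_nat (V 0) V) e)"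
    using e candidate_V[OF candidate_creducible] candidate_SN[OF candidate_reducible] by blast
  then have "SN ndred e"
    by (rule SN_simulation) (rule ndred_psubst)
  \<comment> \<open>The hypothesis on the body belongs to the induction statement, as it has to
    follow \<open>e\<close> along reduction.\<close>
  then have "(\<forall>u. creducible s u \<longrightarrow> reducible \<tau> (psubst (case_nat u V) e)) \<longrightarrow>
      (\<forall>u. creducible s u \<longrightarrow> reducible \<tau> (A (L e) u))"
  proof (induction rule: SN_induct)
    case outer: (step e)
    have "(\<forall>u. creducible s u \<longrightarrow> reducible \<tau> (psubst (case_nat u V) e)) \<longrightarrow>
        creducible s u \<longrightarrow> reducible \<tau> (A (L e) u)" if "SN ndred u" for u
      using that
    proof (induction rule: SN_induct)
      case (step u)
      show ?case
      proof ((rule impI)+, rule candidate_neutral[OF candidate_reducible])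
        fix f
        assume e: "\<forall>u. creducible s u \<longrightarrow> reducible \<tau> (psubst (case_nat u V) e)"
          and u: "creducible s u" and "ndred (A (L e) u) f"
        from this(3) show "reducible \<tau> f"
        proof (cases rule: ndred.cases)
          case (app1 e')
          then obtain e0 where e0: "e' = L e0" "ndred e e0"
            by (auto elim: ndred_LE)
          have "\<forall>u. creducible s u \<longrightarrow> reducible \<tau> (psubst (case_nat u V) e0)"
            using e candidate_ndred[OF candidate_reducible] ndred_psubst[OF e0(2)] by blast
          then show ?thesis
            using outer.IH[OF e0(2)] u app1 e0 by blast
        next
          case (app2 f')
          then show ?thesis
            using step.IH e candidate_ndred[OF candidate_creducible u] by blast
        qed (use e u in auto)
      qed auto
    qed
    then show ?case
      using candidate_SN[OF candidate_creducible] by blast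
  qed
  with e show ?thesis
    by simp
qed

text \<open>A generator can vanish without shifting because it binds a name and no variable.\<close>

primrec erase :: "tm \<Rightarrow> nd" where
  "erase (Var x) = V x"
| "erase (Lam t) = L (erase t)"
| "erase (App t u) = A (erase t) (erase u)"
| "erase (Choice a i t u) = Amb (erase t) (erase u)"
| "erase (Nu t) = erase t"
| "erase (CApp t u) = A (erase t) (erase u)"

lemma reducible_L_psubst:
  assumes "\<And>\<sigma>. (\<forall>x < length (s # \<Gamma>). creducible ((s # \<Gamma>) ! x) (\<sigma> x)) \<Longrightarrow>
      reducible \<tau> (psubst \<sigma> e)"
    and "\<forall>x < length \<Gamma>. creducible (\<Gamma> ! x) (\<sigma> x)"
  shows "reducible (Arr s \<tau>) (psubst \<sigma> (L e))"
proof -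
  have "reducible \<tau> (psubst (case_nat u V) (psubst (ups \<sigma>) e))" if "creducible s u" for u
    unfolding psubst_ups_instantiate
    by (rule assms(1)) (use assms(2) that in \<open>auto split: nat.split\<close>)
  then show ?thesis
    unfolding psubst.simps by (rule reducible_L)
qed

text \<open>The fundamental lemma of reducibility. With the flag \<open>False\<close> the case
  \<open>disj\<close> is vacuous, and \<open>count\<close> keeps the erased term while changing only
  the weight of its type.\<close>

lemma typing_reducible:
  assumes "typing False \<Gamma> X t b s" and "\<forall>x < length \<Gamma>. creducible (\<Gamma> ! x) (\<sigma> x)"
  shows "creducible s (psubst \<sigma> (erase t))"
  using assms
proof (induction arbitrary: \<sigma> rule: typing.induct)
  case (plus a X b \<Gamma> t c s u e i)
  then show ?case
    unfolding erase.simps psubst.simps by (intro candidate_Amb[OF candidate_creducible])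
next
  case (lam s \<Gamma> X t b q \<tau>)
  then show ?case
    using reducible_L_psubst[of s \<Gamma> \<tau> "erase t"] by simp
qed auto

text \<open>In \<open>capp\<close> the argument type and the domain of the function differ only in
  their weights, so reducibility identifies them.\<close>

lemma typing_cbv_reducible:
  assumes "typing_cbv False \<Gamma> X t b s" and "\<forall>x < length \<Gamma>. creducible (\<Gamma> ! x) (\<sigma> x)"
  shows "creducible s (psubst \<sigma> (erase t))"
  using assms
proof (induction arbitrary: \<sigma> rule: typing_cbv.induct)
  case (plus a X b \<Gamma> t c s u e i)
  then show ?case
    unfolding erase.simps psubst.simps by (intro candidate_Amb[OF candidate_creducible])
next
  case (lam s \<Gamma> X t b qs \<tau>)
  then show ?case
    using reducible_L_psubst[of s \<Gamma> \<tau> "erase t"] by simp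
qed auto

lemma SN_ndred_if_reducible:
  assumes "\<And>\<sigma>. \<forall>x < length \<Gamma>. creducible (\<Gamma> ! x) (\<sigma> x) \<Longrightarrow> creducible s (psubst \<sigma> e)"
  shows "SN ndred e"
proof -
  have "creducible s (psubst V e)"
    by (rule assms) (simp add: candidate_V[OF candidate_creducible])
  then show ?thesis
    using candidate_SN[OF candidate_creducible, of s e] by simp
qed

section \<open>Covering\<close>

inductive cov :: "nd \<Rightarrow> tm \<Rightarrow> bool" where
  var: "cov (V x) (Var x)"
| lam: "cov e t \<Longrightarrow> cov (L e) (Lam t)"
| app: "cov e t \<Longrightarrow> cov f u \<Longrightarrow> cov (A e f) (App t u)"
| capp: "cov e t \<Longrightarrow> cov f u \<Longrightarrow> cov (A e f) (CApp t u)"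
| choice: "cov e t \<Longrightarrow> cov e u \<Longrightarrow> cov e (Choice a i t u)"
| nu: "cov e t \<Longrightarrow> cov e (Nu t)"
| step: "ndred e f \<Longrightarrow> cov f t \<Longrightarrow> cov e t"

lemma cov_erase: "cov (erase t) t"
  by (induction t) (auto intro: cov.intros ndred.proj1 ndred.proj2)

lemma cov_rtrancl: "ndred\<^sup>*\<^sup>* e f \<Longrightarrow> cov f t \<Longrightarrow> cov e t"
  by (induction rule: converse_rtranclp_induct) (auto intro: cov.step)

lemma cov_LamI: "ndred\<^sup>*\<^sup>* e (L f) \<Longrightarrow> cov f t \<Longrightarrow> cov e (Lam t)"
  and cov_AppI: "ndred\<^sup>*\<^sup>* e (A f g) \<Longrightarrow> cov f t \<Longrightarrow> cov g u \<Longrightarrow> cov e (App t u)"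
  and cov_CAppI: "ndred\<^sup>*\<^sup>* e (A f g) \<Longrightarrow> cov f t \<Longrightarrow> cov g u \<Longrightarrow> cov e (CApp t u)"
  by (blast intro: cov_rtrancl cov.lam cov.app cov.capp)+

text \<open>Any reduction of \<open>e\<close> that precedes the rule \<open>choice\<close> can be
  repeated in front of each branch separately. Permuting choices thereby becomes propositional
  reasoning.\<close>

lemma cov_Choice_iff [simp]: "cov e (Choice a i t u) \<longleftrightarrow> cov e t \<and> cov e u"
proof
  show "cov e t \<and> cov e u" if "cov e (Choice a i t u)"
    using that by (induction e "Choice a i t u" rule: cov.induct) (auto intro: cov.step)
qed (auto intro: cov.choice)

lemma cov_Nu_iff [simp]: "cov e (Nu t) \<longleftrightarrow> cov e t"
proof
  show "cov e t" if "cov e (Nu t)"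
    using that by (induction e "Nu t" rule: cov.induct) (auto intro: cov.step)
qed (auto intro: cov.nu)

lemma cov_LamE:
  assumes "cov e (Lam t)"
  obtains f where "ndred\<^sup>*\<^sup>* e (L f)" "cov f t"
  using assms
  by (induction e "Lam t" arbitrary: thesis rule: cov.induct)
    (auto intro: converse_rtranclp_into_rtranclp)

lemma cov_AppE:
  assumes "cov e (App t u)"
  obtains f g where "ndred\<^sup>*\<^sup>* e (A f g)" "cov f t" "cov g u"
  using assms
  by (induction e "App t u" arbitrary: thesis rule: cov.induct)
    (auto intro: converse_rtranclp_into_rtranclp)

lemma cov_CAppE:
  assumes "cov e (CApp t u)"
  obtains f g where "ndred\<^sup>*\<^sup>* e (A f g)" "cov f t" "cov g u"
  using assms
  by (induction e "CApp t u" arbitrary: thesis rule: cov.induct)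
    (auto intro: converse_rtranclp_into_rtranclp)

lemma cov_nshift: "cov e t \<Longrightarrow> cov e (nshift k t)"
  by (induction arbitrary: k rule: cov.induct) (auto intro: cov.intros)

lemma cov_nshiftD: "cov e (nshift k t) \<Longrightarrow> cov e t"
proof (induction t arbitrary: e k)
  case (Var x)
  then show ?case by simp
next
  case (Lam t)
  then show ?case by (auto elim!: cov_LamE intro: cov_LamI)
next
  case (App t u)
  then show ?case by (auto elim!: cov_AppE intro: cov_AppI)
next
  case (CApp t u)
  then show ?case by (auto elim!: cov_CAppE intro: cov_CAppI)
qed auto

lemma cov_vshift: "cov e t \<Longrightarrow> cov (ren (\<lambda>x. if x < k then x else Suc x) e) (vshift k t)"
proof (induction arbitrary: k rule: cov.induct)
  case (lam e t)
  have "case_nat 0 (Suc \<circ> (\<lambda>x. if x < k then x else Suc x)) =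
      (\<lambda>x. if x < Suc k then x else Suc x)"
    by (auto simp: fun_eq_iff split: nat.split)
  with lam.IH[of "Suc k"] show ?case
    by (auto intro: cov.lam)
next
  case (step e f t)
  then show ?case
    using ndred_ren cov.step by blast
qed (auto intro: cov.intros)

text \<open>Each occurrence of the variable \<open>k\<close> receives its own copy of
  \<open>\<sigma> k\<close>, and the copies may reduce to different branches.\<close>

lemma cov_subst:
  assumes "cov e t" and "\<And>x. x < k \<Longrightarrow> \<sigma> x = V x" and "cov (\<sigma> k) u"
    and "\<And>x. k < x \<Longrightarrow> \<sigma> x = V (x - 1)"
  shows "cov (psubst \<sigma> e) (subst t u k)"
  using assms
proof (induction arbitrary: \<sigma> u k rule: cov.induct)
  case (var x)
  then show ?case
    by (cases x k rule: linorder_cases) (auto intro: cov.var)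
next
  case (lam e t)
  have "cov (psubst (ups \<sigma>) e) (subst t (vshift 0 u) (Suc k))"
  proof (rule lam.IH)
    show "ups \<sigma> x = V x" if "x < Suc k" for x
      using that lam.prems(1) by (cases x) auto
    show "ups \<sigma> x = V (x - 1)" if "Suc k < x" for x
      using that lam.prems(3) by (cases x) auto
    show "cov (ups \<sigma> (Suc k)) (vshift 0 u)"
      using cov_vshift[OF lam.prems(2), of 0] by (simp add: eta_contract_eq)
  qed
  then show ?case
    by (auto intro: cov.lam)
next
  case (step e f t)
  then show ?case
    using ndred_psubst cov.step by blast
next
  case (nu e t)
  then show ?case
    by (auto intro!: nu.IH cov_nshift)
qed (auto intro: cov.intros)

text \<open>Covering the redex forces \<open>e\<close> to reach a redex of its own; contracting it
  makes the reduction nonempty, which is the decrease driving the main induction.\<close>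

lemma cov_beta:
  assumes "cov e (App (Lam t) u)"
  obtains f where "ndred\<^sup>+\<^sup>+ e f" "cov f (subst t u 0)"
proof -
  from assms obtain e1 e2 where e: "ndred\<^sup>*\<^sup>* e (A e1 e2)" "cov e1 (Lam t)" "cov e2 u"
    by (rule cov_AppE)
  from e(2) obtain e0 where e0: "ndred\<^sup>*\<^sup>* e1 (L e0)" "cov e0 t"
    by (rule cov_LamE)
  from e0(1) have "ndred\<^sup>*\<^sup>* (A e1 e2) (A (L e0) e2)"
    by (induction rule: rtranclp_induct) (auto intro: rtranclp.rtrancl_into_rtrancl ndred.app1)
  with e(1) have "ndred\<^sup>+\<^sup>+ e (psubst (case_nat e2 V) e0)"
    by (meson ndred.beta rtranclp_into_tranclp1 rtranclp_trans)
  moreover have "cov (psubst (case_nat e2 V) e0) (subst t u 0)"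
    by (rule cov_subst[OF e0(2)]) (use e(3) in \<open>auto split: nat.split\<close>)
  ultimately show thesis
    by (rule that)
qed

text \<open>A choice leaving an application or abstraction duplicates its context, and the reduct of
  \<open>e\<close> matching that context covers both copies.\<close>

lemma cov_perm: "perm t t' \<Longrightarrow> cov e t \<Longrightarrow> cov e t'"
  by (induction rule: perm.induct)
    (auto elim!: cov_LamE cov_AppE intro: cov_LamI cov_AppI cov_nshift cov_nshiftD)

text \<open>Turning \<open>CApp\<close> into \<open>App\<close> is harmless, as both are covered by
  \<open>A\<close>.\<close>

lemma cov_perm_cbv: "perm_cbv t t' \<Longrightarrow> cov e t \<Longrightarrow> cov e t'"
  by (induction rule: perm_cbv.induct)
    (auto elim!: cov_CAppE intro: cov_AppI cov_CAppI cov_nshift)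

lemma cov_red_cbv:
  assumes "red_cbv t t'" and "cov e t"
  shows "cov e t'"
  using assms unfolding red_cbv_def
proof (induction arbitrary: e rule: compat.induct)
  case (root t u)
  then show ?case
    \<comment> \<open>After a \<beta>-step a reduct of \<open>e\<close> covers the result, and
      covering passes back from the reduct to \<open>e\<close>.\<close>
    by (auto elim!: beta.cases cov_beta dest: cov_perm cov_perm_cbv tranclp_into_rtranclp
        intro: cov_rtrancl)
qed (auto elim!: cov_LamE cov_AppE cov_CAppE intro: cov_LamI cov_AppI cov_CAppI)

section \<open>Strong normalization of covered terms\<close>

lemma names_nshift: "a \<in> names (nshift k t) \<longleftrightarrow> (\<exists>b\<in>names t. a = (if b < k then b else Suc b))"
proof (induction t arbitrary: a k)
  case (Nu t)
  have "(\<exists>b\<in>names t. Suc a = (if b < Suc k then b else Suc b)) \<longleftrightarrow>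
      (\<exists>b. Suc b \<in> names t \<and> a = (if b < k then b else Suc b))" (is "?l \<longleftrightarrow> ?r")
  proof
    assume ?l
    then obtain b where b: "b \<in> names t" "Suc a = (if b < Suc k then b else Suc b)"
      by blast
    then show ?r
      by (cases b) (auto split: if_splits)
  next
    assume ?r
    then show ?l
      by force
  qed
  with Nu show ?case
    by auto
qed (auto split: if_splits)

lemma names_vshift [simp]: "names (vshift k t) = names t"
  by (induction t arbitrary: k) auto

lemma names_subst: "names (subst t u k) \<subseteq> names t \<union> names u"
proof (induction t arbitrary: u k)
  case (Lam t)
  then show ?case
    using names_vshift by fastforce
next
  case (Nu t)
  show ?case
    using Nu[of "nshift 0 u" k] by (auto simp: names_nshift)
next
  case (Choice a i t1 t2)
  then show ?case
    by simp blast
next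
  case (App t1 t2)
  then show ?case
    by simp blast
next
  case (CApp t1 t2)
  then show ?case
    by simp blast
qed simp

lemma finite_names: "finite (names t)"
proof (induction t)
  case (Nu t)
  have "names (Nu t) = Suc -` names t"
    by auto
  with Nu show ?case
    by (metis finite_vimageI inj_Suc)
qed auto

lemma names_red_cbv: "red_cbv t t' \<Longrightarrow> names t' \<subseteq> names t"
  unfolding red_cbv_def
proof (induction rule: compat.induct)
  case (root t u)
  then show ?case
    using names_subst by (fastforce elim!: beta.cases perm.cases perm_cbv.cases simp: names_nshift)
qed auto

section \<open>Stability of reduction under shifting of names\<close>

lemma vshift_nshift: "vshift j (nshift k t) = nshift k (vshift j t)"
  by (induction t arbitrary: j k) auto

lemma nshift_nshift: "i \<le> k \<Longrightarrow> nshift (Suc k) (nshift i t) = nshift i (nshift k t)"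
  by (induction t arbitrary: i k) auto

lemma nshift_subst: "nshift k (subst t u j) = subst (nshift k t) (nshift k u) j"
  by (induction t arbitrary: k u j) (auto simp: vshift_nshift nshift_nshift)

text \<open>Shifting names is strictly monotone, so it respects the label order.\<close>

lemma perm_nshift: "perm t t' \<Longrightarrow> perm (nshift k t) (nshift k t')"
proof (induction arbitrary: k rule: perm.induct)
  case (plus_plus1 a i b j t u v)
  then show ?case
    using perm.plus_plus1[of "if a < k then a else Suc a" i "if b < k then b else Suc b" j]
    by (auto simp: label_less_def split: if_splits)
next
  case (plus_plus2 a i b j t u v)
  then show ?case
    using perm.plus_plus2[of "if a < k then a else Suc a" i "if b < k then b else Suc b" j]
    by (auto simp: label_less_def split: if_splits)
qed (auto simp: nshift_nshift intro: perm.intros)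

lemma perm_cbv_nshift: "perm_cbv t t' \<Longrightarrow> perm_cbv (nshift k t) (nshift k t')"
  by (induction rule: perm_cbv.induct) (auto simp: nshift_nshift intro: perm_cbv.intros)

lemma red_cbv_nshift:
  assumes "red_cbv t t'"
  shows "red_cbv (nshift k t) (nshift k t')"
  using assms unfolding red_cbv_def
proof (induction arbitrary: k rule: compat.induct)
  case (root t u)
  then have "sup beta (sup perm perm_cbv) (nshift k t) (nshift k u)"
    by (auto simp: nshift_subst perm_nshift perm_cbv_nshift elim!: beta.cases intro: beta.intros)
  then show ?case
    by (rule compat.root)
qed (auto intro: compat.intros)

section \<open>Components and inversion of reduction steps\<close>

text \<open>Only choices and generators are included: they are what permutations move outwards,
  leaving their components in place.\<close>

inductive child :: "tm \<Rightarrow> tm \<Rightarrow> bool" where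
  "child (Choice a i t u) t"
| "child (Choice a i t u) u"
| "child (Nu t) t"

lemma SN_child: "SN child t"
  by (induction t; rule SNI; auto elim: child.cases)

lemma SN_red_cbv_child: "SN red_cbv t \<Longrightarrow> SN (sup red_cbv child) t"
  by (rule SN_sup_commuting[OF _ _ SN_child])
    (auto simp: red_cbv_def elim!: child.cases intro: compat.intros child.intros)

lemma red_cbv_ChoiceE:
  assumes "red_cbv (Choice b j t u) s"
  obtains t' where "s = Choice b j t' u" "red_cbv t t'"
  | u' where "s = Choice b j t u'" "red_cbv u u'"
  | "s = t" "t = u"
  | t1 t2 where "t = Choice b j t1 t2" "s = Choice b j t1 u"
  | u1 u2 where "u = Choice b j u1 u2" "s = Choice b j t u2"
  | a i t1 t2 where "t = Choice a i t1 t2" "label_less (a, i) (b, j)"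
      "s = Choice a i (Choice b j t1 u) (Choice b j t2 u)"
  | a i u1 u2 where "u = Choice a i u1 u2" "label_less (a, i) (b, j)"
      "s = Choice a i (Choice b j t u1) (Choice b j t u2)"
  using assms unfolding red_cbv_def
proof (cases rule: compat.cases)
  case root
  then have "perm (Choice b j t u) s"
    by (auto elim: beta.cases perm_cbv.cases)
  then show thesis
  proof (cases rule: perm.cases)
    case idem
    then show ?thesis
      by (intro that(3)) simp_all
  next
    case c1
    then show ?thesis
      by - (rule that(4), assumption+)
  next
    case c2
    then show ?thesis
      by - (rule that(5), assumption+)
  next
    case plus_plus1
    then show ?thesis
      by - (rule that(6), assumption+)
  next
    case plus_plus2
    then show ?thesis
      by - (rule that(7), assumption+)
  qed
next
  case choice1
  then show thesis
    by (intro that(1)) (simp_all add: red_cbv_def)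
next
  case choice2
  then show thesis
    by (intro that(2)) (simp_all add: red_cbv_def)
qed

lemma red_cbv_NuE:
  assumes "red_cbv (Nu t) s"
  obtains t' where "s = Nu t'" "red_cbv t t'"
  | a i t1 t2 where "t = Choice (Suc a) i t1 t2" "s = Choice a i (Nu t1) (Nu t2)"
  | "t = nshift 0 s"
  using assms unfolding red_cbv_def
  by (cases rule: compat.cases) (auto elim!: beta.cases perm.cases perm_cbv.cases)

lemma red_cbv_LamE:
  assumes "red_cbv (Lam t) s"
  obtains t' where "s = Lam t'" "red_cbv t t'"
  | a i t1 t2 where "t = Choice a i t1 t2" "s = Choice a i (Lam t1) (Lam t2)"
  | t' where "t = Nu t'" "s = Nu (Lam t')"
  using assms unfolding red_cbv_def
  by (cases rule: compat.cases) (auto elim!: beta.cases perm.cases perm_cbv.cases)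

lemma red_cbv_AppE:
  assumes "red_cbv (App t u) s"
  obtains t' where "s = App t' u" "red_cbv t t'"
  | u' where "s = App t u'" "red_cbv u u'"
  | t' where "t = Lam t'" "s = subst t' u 0"
  | a i t1 t2 where "t = Choice a i t1 t2" "s = Choice a i (App t1 u) (App t2 u)"
  | a i u1 u2 where "u = Choice a i u1 u2" "s = Choice a i (App t u1) (App t u2)"
  | t' where "t = Nu t'" "s = Nu (App t' (nshift 0 u))"
  using assms unfolding red_cbv_def
  by (cases rule: compat.cases) (auto elim!: beta.cases perm.cases perm_cbv.cases)

lemma red_cbv_CAppE:
  assumes "red_cbv (CApp t u) s"
  obtains t' where "s = CApp t' u" "red_cbv t t'"
  | u' where "s = CApp t u'" "red_cbv u u'"
  | a i t1 t2 where "t = Choice a i t1 t2" "s = Choice a i (CApp t1 u) (CApp t2 u)"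
  | a i u1 u2 where "u = Choice a i u1 u2" "s = Choice a i (CApp t u1) (CApp t u2)"
  | u' where "u = Nu u'" "s = Nu (App (nshift 0 t) u')"
  using assms unfolding red_cbv_def
  by (cases rule: compat.cases) (auto elim!: beta.cases perm.cases perm_cbv.cases)

section \<open>Closure under choices, generators and abstractions\<close>

text \<open>The label order has infinite descending chains, as names grow; it is well-founded below any
  bound \<open>K\<close> on the free names, and reduction creates no free names.\<close>

lemma SN_Choice_bounded:
  assumes "SN red_cbv t" "SN red_cbv u" "names t \<subseteq> {..K}" "names u \<subseteq> {..K}" "b \<le> K"
  shows "SN red_cbv (Choice b j t u)"
  using assms
\<comment> \<open>The measure decreases lexicographically when a choice with a smaller label moves
  outwards: either its name is larger, still at most \<open>K\<close>, or the name is equal and the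
  bit index smaller.\<close>
proof (induction "(K - b, j)" arbitrary: b j t u
    rule: wf_induct_rule[OF wf_lex_prod[OF wf_less_than wf_less_than]])
  case less: 1
  have outermost: "SN red_cbv (Choice a i t' u')"
    if "label_less (a, i) (b, j)" "a \<le> K" "SN red_cbv t'" "SN red_cbv u'"
      "names t' \<subseteq> {..K}" "names u' \<subseteq> {..K}" for a i t' u'
    by (rule less.hyps) (use that in \<open>auto simp: label_less_def\<close>)
  \<comment> \<open>Commutation leaves components of \<open>t\<close> or \<open>u\<close> under the
    label \<open>(b, j)\<close>, so the inner inductions run over reduction and components
    together.\<close>
  have "\<forall>u. SN (sup red_cbv child) u \<longrightarrow> names t \<subseteq> {..K} \<longrightarrow> names u \<subseteq> {..K} \<longrightarrow>
      SN red_cbv (Choice b j t u)"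
    using SN_red_cbv_child[OF less.prems(1)]
  proof (induction rule: SN_induct)
    case t: (step t)
    have IH1: "SN red_cbv (Choice b j t' u)"
      if "sup red_cbv child t t'" "SN (sup red_cbv child) u"
        "names t' \<subseteq> {..K}" "names u \<subseteq> {..K}" for t' u
      using t.IH that by blast
    have "names t \<subseteq> {..K} \<longrightarrow> names u \<subseteq> {..K} \<longrightarrow> SN red_cbv (Choice b j t u)"
      if "SN (sup red_cbv child) u" for u
      using that
    proof (induction rule: SN_induct)
      case u: (step u)
      show ?case
      proof ((rule impI)+, rule SNI)
        fix s
        assume K: "names t \<subseteq> {..K}" "names u \<subseteq> {..K}" and "red_cbv (Choice b j t u) s"
        from this(3) show "SN red_cbv s"
        proof (cases rule: red_cbv_ChoiceE)
          case (1 t')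
          then show ?thesis
            using IH1[of t' u] u.hyps K names_red_cbv by blast
        next
          case (2 u')
          then show ?thesis
            using u.IH[of u'] K names_red_cbv by blast
        next
          case 3
          then show ?thesis
            using SN_mono[OF t.hyps] by blast
        next
          case (4 t1 t2)
          then show ?thesis
            using IH1[of t1 u] u.hyps K by (auto intro: child.intros)
        next
          case (5 u1 u2)
          then show ?thesis
            using u.IH[of u2] K by (auto intro: child.intros)
        next
          case (6 a i t1 t2)
          then show ?thesis
            using K less.prems(5)
            by (auto intro!: outermost[OF 6(2)] IH1 u.hyps intro: child.intros)
        next
          case (7 a i u1 u2)
          then show ?thesis
            using u.IH[of u1] u.IH[of u2] K less.prems(5)
            by (auto intro!: outermost[OF 7(2)] intro: child.intros)
        qed
      qed
    qed
    then show ?case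
      by blast
  qed
  then show ?case
    using less.prems SN_red_cbv_child by blast
qed

lemma SN_Choice:
  assumes "SN red_cbv t" "SN red_cbv u"
  shows "SN red_cbv (Choice a i t u)"
proof -
  have "finite (insert a (names t \<union> names u))"
    by (simp add: finite_names)
  then obtain K where "insert a (names t \<union> names u) \<subseteq> {..K}"
    by (meson finite_nat_iff_bounded_le)
  with assms show ?thesis
    by (intro SN_Choice_bounded[where K = K]) auto
qed

lemma SN_Nu:
  assumes "SN red_cbv t"
  shows "SN red_cbv (Nu t)"
  using SN_red_cbv_child[OF assms]
proof (induction rule: SN_induct)
  case (step t)
  have "SN red_cbv t"
    using SN_mono[OF step.hyps] by blast
  show ?case
  proof (rule SNI)
    fix s
    assume "red_cbv (Nu t) s"
    then show "SN red_cbv s"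
    proof (cases rule: red_cbv_NuE)
      case 3
      show ?thesis
        \<comment> \<open>Here \<open>t\<close> is the shifted \<open>s\<close>, so any reduction of
          \<open>s\<close> shifts to one of \<open>t\<close>.\<close>
        by (rule SN_simulation[where f = "nshift 0"])
          (use \<open>SN red_cbv t\<close> 3 red_cbv_nshift in auto)
    qed (use step.IH in \<open>auto intro!: SN_Choice intro: child.intros\<close>)
  qed
qed

lemma SN_Lam:
  assumes "SN red_cbv t"
  shows "SN red_cbv (Lam t)"
  using SN_red_cbv_child[OF assms]
proof (induction rule: SN_induct)
  case (step t)
  show ?case
  proof (rule SNI)
    fix s
    assume "red_cbv (Lam t) s"
    then show "SN red_cbv s"
      by (cases rule: red_cbv_LamE)
        (use step.IH in \<open>auto intro!: SN_Choice SN_Nu intro: child.intros\<close>)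
  qed
qed

section \<open>Covered applications\<close>

text \<open>Covering by the fixed \<open>e\<close> and \<open>f\<close> survives every reduction and
  passage to a component, so nested induction on \<open>t\<close> and \<open>u\<close> meets only
  covered terms; \<beta>-steps at the root are left to the first hypothesis.\<close>

lemma SN_App_covered:
  assumes beta: "\<And>t u. cov (A e f) (App (Lam t) u) \<Longrightarrow> SN red_cbv (subst t u 0)"
    and e: "\<And>t. cov e t \<Longrightarrow> SN red_cbv t" and f: "\<And>u. cov f u \<Longrightarrow> SN red_cbv u"
    and "cov e t" "cov f u"
  shows "SN red_cbv (App t u)"
proof -
  have "cov e t \<longrightarrow> (\<forall>u. cov f u \<longrightarrow> SN red_cbv (App t u))"
    using SN_red_cbv_child[OF e[OF \<open>cov e t\<close>]]
  proof (induction rule: SN_induct)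
    case t: (step t)
    have "cov e t \<longrightarrow> cov f u \<longrightarrow> SN red_cbv (App t u)" if "SN (sup red_cbv child) u" for u
      using that
    proof (induction rule: SN_induct)
      case u: (step u)
      show ?case
      proof ((rule impI)+, rule SNI)
        fix s
        assume c: "cov e t" "cov f u" and "red_cbv (App t u) s"
        from this(3) show "SN red_cbv s"
        proof (cases rule: red_cbv_AppE)
          case (1 t')
          then show ?thesis
            using t.IH[of t'] c cov_red_cbv by blast
        next
          case (2 u')
          then show ?thesis
            using u.IH[of u'] c cov_red_cbv by blast
        next
          case (3 t')
          then show ?thesis
            using beta c cov.app by blast
        next
          case (4 a i t1 t2)
          then show ?thesis
            using t.IH[of t1] t.IH[of t2] c by (auto intro!: SN_Choice intro: child.intros)
        next
          case (5 a i u1 u2)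
          then show ?thesis
            using u.IH[of u1] u.IH[of u2] c by (auto intro!: SN_Choice intro: child.intros)
        next
          \<comment> \<open>The argument becomes \<open>nshift 0 u\<close>, not a reduct of
            \<open>u\<close>; the outer hypothesis applies because it holds for every argument
            covered by \<open>f\<close>.\<close>
          case (6 t')
          then show ?thesis
            using t.IH[of t'] c cov_nshift by (auto intro!: SN_Nu intro: child.intros)
        qed
      qed
    qed
    then show ?case
      using f SN_red_cbv_child by blast
  qed
  with assms show ?thesis
    by blast
qed

text \<open>There is no \<beta>-step at a \<open>CApp\<close>; a generator leaving the argument
  produces an \<open>App\<close>, which is why ordinary applications come first.\<close>

lemma SN_CApp_covered:
  assumes app: "\<And>t u. cov e t \<Longrightarrow> cov f u \<Longrightarrow> SN red_cbv (App t u)"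
    and e: "\<And>t. cov e t \<Longrightarrow> SN red_cbv t" and f: "\<And>u. cov f u \<Longrightarrow> SN red_cbv u"
    and "cov e t" "cov f u"
  shows "SN red_cbv (CApp t u)"
proof -
  have "cov e t \<longrightarrow> (\<forall>u. cov f u \<longrightarrow> SN red_cbv (CApp t u))"
    using SN_red_cbv_child[OF e[OF \<open>cov e t\<close>]]
  proof (induction rule: SN_induct)
    case t: (step t)
    have "cov e t \<longrightarrow> cov f u \<longrightarrow> SN red_cbv (CApp t u)" if "SN (sup red_cbv child) u" for u
      using that
    proof (induction rule: SN_induct)
      case u: (step u)
      show ?case
      proof ((rule impI)+, rule SNI)
        fix s
        assume c: "cov e t" "cov f u" and "red_cbv (CApp t u) s"
        from this(3) show "SN red_cbv s"
        proof (cases rule: red_cbv_CAppE)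
          case (1 t')
          then show ?thesis
            using t.IH[of t'] c cov_red_cbv by blast
        next
          case (2 u')
          then show ?thesis
            using u.IH[of u'] c cov_red_cbv by blast
        next
          case (3 a i t1 t2)
          then show ?thesis
            using t.IH[of t1] t.IH[of t2] c by (auto intro!: SN_Choice intro: child.intros)
        next
          case (4 a i u1 u2)
          then show ?thesis
            using u.IH[of u1] u.IH[of u2] c by (auto intro!: SN_Choice intro: child.intros)
        next
          case (5 u')
          then show ?thesis
            using app c cov_nshift by (auto intro!: SN_Nu)
        qed
      qed
    qed
    then show ?case
      using f SN_red_cbv_child by blast
  qed
  with assms show ?thesis
    by blast
qed

section \<open>Induction on the covering term\<close>

lemma SN_covered:
  assumes "SN ndred e" and "cov e t"
  shows "SN red_cbv t"
  using SN_ndred_child[OF assms(1)] assms(2)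
proof (induction arbitrary: t rule: SN_induct)
  case (step e t)
  have ndred: "SN red_cbv t" if "ndred e f" "cov f t" for f t
    using step.IH that by blast
  have child: "SN red_cbv t" if "cov f t" "ndchild e f" for f t
    using step.IH that by blast
  have beta: "SN red_cbv (subst t u 0)" if "cov e (App (Lam t) u)" for t u
  proof -
    from that obtain f where "ndred\<^sup>+\<^sup>+ e f" "cov f (subst t u 0)"
      by (rule cov_beta)
    \<comment> \<open>The first step of the nonempty reduction gives a proper reduct of
      \<open>e\<close>, to which the covering passes back along the remaining steps.\<close>
    then obtain f' where "ndred e f'" "cov f' (subst t u 0)"
      by (metis tranclpD cov_rtrancl)
    then show ?thesis
      by (rule ndred)
  qed
  have app: "SN red_cbv (App t u)" if "e = A f g" "cov f t" "cov g u" for f g t u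
    by (rule SN_App_covered[where e = f and f = g])
      (use that beta in \<open>auto dest: child intro: ndchild.intros\<close>)
  have capp: "SN red_cbv (CApp t u)" if "e = A f g" "cov f t" "cov g u" for f g t u
    by (rule SN_CApp_covered[where e = f and f = g])
      (use that app in \<open>auto dest: child intro: ndchild.intros\<close>)
  show ?case
    using step.prems
  \<comment> \<open>Components of choices and generators are covered by the same \<open>e\<close>,
    so a structural induction on \<open>t\<close> is nested inside the one on
    \<open>e\<close>.\<close>
  proof (induction t rule: tm.induct)
    case (Var x)
    show ?case
      by (rule SNI)
        (auto simp: red_cbv_def elim!: compat.cases beta.cases perm.cases perm_cbv.cases)
  next
    case (Lam t)
    from Lam.prems show ?case
    proof (cases rule: cov.cases)
      case (lam f)
      then show ?thesis
        using SN_Lam child ndchild.intros(1) by blast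
    qed (rule ndred)
  next
    case (App t u)
    from App.prems show ?case
      by (cases rule: cov.cases) (auto intro: ndred app)
  next
    case (CApp t u)
    from CApp.prems show ?case
      by (cases rule: cov.cases) (auto intro: ndred capp)
  qed (auto intro: SN_Choice SN_Nu)
qed

lemma red_imp_red_cbv: "red t u \<Longrightarrow> red_cbv t u"
  unfolding red_def red_cbv_def by (induction rule: compat.induct) (auto intro: compat.intros)

theorem theorem5p3:
  shows "(\<forall>\<Gamma> X t b s. typing False \<Gamma> X t b s \<longrightarrow> termip red t) \<and>
         (\<forall>\<Gamma> X t b s. typing_cbv False \<Gamma> X t b s \<longrightarrow> termip red_cbv t)"
proof (intro conjI allI impI)
  fix \<Gamma> X t b s
  assume "typing False \<Gamma> X t b s"
  then have "SN ndred (erase t)"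
    by (intro SN_ndred_if_reducible) (rule typing_reducible)
  then have "SN red_cbv t"
    using cov_erase by (rule SN_covered)
  \<comment> \<open>Call-by-name reduction is contained in call-by-value reduction, so one argument
    serves both systems.\<close>
  then have "SN red t"
    by (rule SN_mono) (rule red_imp_red_cbv)
  then show "termip red t"
    by (rule SN_imp_termip)
next
  fix \<Gamma> X t b s
  assume "typing_cbv False \<Gamma> X t b s"
  then have "SN ndred (erase t)"
    by (intro SN_ndred_if_reducible) (rule typing_cbv_reducible)
  then have "SN red_cbv t"
    using cov_erase by (rule SN_covered)
  then show "termip red_cbv t"
    by (rule SN_imp_termip)
qed

end
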